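(* Let $m\ge1$ be an integer and $\mathbf{u}=(1,m+1,2m+1,\dots)$. Let $\mathcal{S}_0,\dots,\mathcal{S}_m$ be $m+1$ statistics $\mathcal{S}_i:\bigcup_{n\ge0}\mathcal{PK}(n;\mathbf{u})\to\mathbb{N}$, each equidistributed with $\mathrm{luck}$, i.e. for all $n\ge 0$ and all $k$, $|\{\mathbf{p}\in\mathcal{PK}(n;\mathbf{u}):\mathcal{S}_i(\mathbf{p})=k\}|=|\{\mathbf{p}\in\mathcal{PK}(n;\mathbf{u}):\mathrm{luck}(\mathbf{p})=k\}|$. Suppose there are constants $C_0,\dots,C_m$, with $C_i$ depending only on $i$, such that for all $n\ge1$ and all $\mathbf{p}\in\mathcal{PK}(n;\mathbf{u})$ with first-return decomposition $(\mathbf{p}_1,\dots,\mathbf{p}_{m+1})$ one has $\mathcal{S}_i(\mathbf{p})=\mathcal{S}_i(\mathbf{p}_{i+1})+C_i$ for $0\le i\le m$. Let $$\Gamma_m(x;q_0,\dots,q_m)=\sum_{n\ge0}x^n\sum_{\mathbf{p}\in\mathcal{PK}(n;\mathbf{u})}q_0^{\mathcal{S}_0(\mathbf{p})}\cdots q_m^{\mathcal{S}_m(\mathbf{p})}.$$ Then $$\Gamma_m(x;q_0,\dots,q_m)=1+x\prod_{i=0}^{m}q_i^{C_i}\,\mathcal{B}_m(x;q_i).$$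
   Context: $\mathcal{PK}(n;\mathbf{u})$ for $\mathbf{u}=(1,m+1,2m+1,\dots)$ is the set of weakly increasing sequences of positive integers $\mathbf{p}=(p_1,\dots,p_n)$ with $p_i\le m(i-1)+1$ for all $i$ (for $n=0$ it contains only the empty sequence $\varepsilon$). $\mathrm{luck}(\mathbf{p})=|\{i:p_i=mi-m+1\}|$, and $\mathcal{B}_m(x;q)=\sum_{n\ge0}x^n\sum_{\mathbf{p}\in\mathcal{PK}(n;\mathbf{u})}q^{\mathrm{luck}(\mathbf{p})}$. $\mathbb{N}$ denotes the nonnegative integers. First-return decomposition of $\mathbf{p}\in\mathcal{PK}(n;\mathbf{u})$, $n\ge1$: for $1\le\ell\le m$ let $i_\ell$ be the first fixed point of type $\ell$, i.e. the smallest $k$ with $1<k\le n$ and $m(k-2)+1+\ell\le p_k\le m(k-1)+1$, with $i_\ell=n+1$ if no such $k$ exists; then $i_1\le i_2\le\dots\le i_m$. Put $i_0=2$ and $i_{m+1}=n+1$. For $1\le j\le m+1$, $\mathbf{p}_j$ is the sequence $(p_{i_{j-1}},\dots,p_{i_j-1})$ with $p_{i_{j-1}}-1$ subtracted from every entry (so that a nonempty $\mathbf{p}_j$ starts with $1$); $\mathbf{p}_j=\varepsilon$ if $i_{j-1}=i_j$. Each $\mathbf{p}_j$ is again a (possibly empty) $\mathbf{u}$-parking distribution for the same $\mathbf{u}$. *)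

theory Defs
  imports
    "HOL-Computational_Algebra.Formal_Power_Series"
    "HOL-Library.Poly_Mapping"
begin

text \<open>
  A sequence \<open>(p\<^sub>1, \<dots>, p\<^sub>n)\<close> is a list of length \<open>n\<close>; \<open>entry p i\<close> is \<open>p\<^sub>i\<close>, with
  positions counted from 1.
\<close>

definition entry :: "nat list \<Rightarrow> nat \<Rightarrow> nat" where
  "entry p i = p ! (i - 1)"

definition PK :: "nat \<Rightarrow> nat \<Rightarrow> nat list set" where
  "PK m n = {p. length p = n \<and> sorted p \<and>
                (\<forall>i\<in>{1..n}. 1 \<le> entry p i \<and> entry p i \<le> m * (i - 1) + 1)}"

lemma finite_PK: "finite (PK m n)"
proof (rule finite_subset)
  show "PK m n \<subseteq> {p. set p \<subseteq> {..m * n + 1} \<and> length p = n}"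
  proof (clarsimp simp: PK_def entry_def in_set_conv_nth)
    fix p :: "nat list" and k
    assume bound: "\<forall>i\<in>{Suc 0..length p}. Suc 0 \<le> p ! (i - Suc 0) \<and> p ! (i - Suc 0) \<le> Suc (m * (i - Suc 0))"
      and "k < length p"
    then have "p ! k \<le> Suc (m * k)"
      using bound[rule_format, of "Suc k"] by simp
    also have "\<dots> \<le> Suc (m * length p)"
      using \<open>k < length p\<close> by simp
    finally show "p ! k \<le> Suc (m * length p)" .
  qed
  show "finite {p. set p \<subseteq> {..m * n + 1} \<and> length p = n}"
    by (rule finite_lists_length_eq) simp
qed

definition luck :: "nat \<Rightarrow> nat list \<Rightarrow> nat" where
  "luck m p = card {i \<in> {1..length p}. entry p i = m * i - m + 1}"

definition fixed_points :: "nat \<Rightarrow> nat \<Rightarrow> nat list \<Rightarrow> nat set" where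
  "fixed_points m l p =
     {k. 1 < k \<and> k \<le> length p \<and>
         m * (k - 2) + 1 + l \<le> entry p k \<and> entry p k \<le> m * (k - 1) + 1}"

definition first_fixed_point :: "nat \<Rightarrow> nat \<Rightarrow> nat list \<Rightarrow> nat" where
  "first_fixed_point m l p =
     (if fixed_points m l p = {} then length p + 1 else Min (fixed_points m l p))"

text \<open>The break points \<open>i\<^sub>0 \<le> i\<^sub>1 \<le> \<dots> \<le> i\<^bsub>m+1\<^esub>\<close>.\<close>

definition break_point :: "nat \<Rightarrow> nat list \<Rightarrow> nat \<Rightarrow> nat" where
  "break_point m p j =
     (if j = 0 then 2
      else if j = m + 1 then length p + 1
      else first_fixed_point m j p)"

text \<open>
  The component \<open>p\<^sub>j\<close> for \<open>1 \<le> j \<le> m + 1\<close>. If \<open>i\<^bsub>j-1\<^esub> = i\<^sub>j\<close>, the index range is empty and so is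
  the component. Neither subtraction truncates on \<open>PK m n\<close>, \<open>n \<ge> 1\<close>, whose members are weakly
  increasing with entries at least 1.
\<close>

definition component :: "nat \<Rightarrow> nat list \<Rightarrow> nat \<Rightarrow> nat list" where
  "component m p j =
     map (\<lambda>k. entry p k - (entry p (break_point m p (j - 1)) - 1))
         [break_point m p (j - 1) ..< break_point m p j]"

text \<open>\<open>\<B>\<^sub>m(x; q)\<close> as a power series in \<open>x\<close>.\<close>

definition luck_gf :: "nat \<Rightarrow> 'a::comm_ring_1 \<Rightarrow> 'a fps" where
  "luck_gf m q = Abs_fps (\<lambda>n. \<Sum>p\<in>PK m n. q ^ luck m p)"

text \<open>\<open>\<Gamma>\<^sub>m(x; q\<^sub>0, \<dots>, q\<^sub>m)\<close> as a power series in \<open>x\<close>, for the statistics \<open>S 0, \<dots>, S m\<close>.\<close>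

definition joint_gf :: "nat \<Rightarrow> (nat \<Rightarrow> nat list \<Rightarrow> nat) \<Rightarrow> (nat \<Rightarrow> 'a::comm_ring_1) \<Rightarrow> 'a fps" where
  "joint_gf m S q = Abs_fps (\<lambda>n. \<Sum>p\<in>PK m n. \<Prod>i\<in>{0..m}. q i ^ S i p)"

text \<open>
  The ring \<open>\<int>[q\<^sub>0, q\<^sub>1, \<dots>]\<close> of integer polynomials in countably many indeterminates: a monomial is a
  finitely supported exponent vector, a polynomial a finitely supported family of coefficients
  indexed by monomials, and \<open>indet i\<close> is the \<open>i\<close>-th indeterminate.
\<close>

type_synonym int_mpoly = "(nat \<Rightarrow>\<^sub>0 nat) \<Rightarrow>\<^sub>0 int"

definition indet :: "nat \<Rightarrow> int_mpoly" where
  "indet i = Poly_Mapping.single (Poly_Mapping.single i 1) 1"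

end

theory Submission
  imports Defs
begin

text \<open>
  Every \<open>p \<in> PK m n\<close> with \<open>n \<ge> 1\<close> is \<open>1 # q\<close>, where \<open>q\<close> is a weakly increasing positive sequence
  with \<open>q ! k \<le> m * k + (m + 1)\<close>. Replacing \<open>m + 1\<close> by an arbitrary offset \<open>l\<close> gives sets
  \<open>bounded_seqs m l n\<close>, which interpolate between the empty sequence alone (\<open>l = 0\<close>),
  \<open>PK m n\<close> (\<open>l = 1\<close>) and the tails of parking distributions (\<open>l = m + 1\<close>). A sequence of offset
  \<open>l + 1\<close> splits uniquely at the first place \<open>b\<close> where it exceeds the bound for offset \<open>l\<close>,
  or at its end if there is none: what
  comes before has offset \<open>l\<close>, and what follows, lowered by \<open>m * b + l\<close>, is an arbitrary parking
  distribution (lemma \<open>bij_betw_glue\<close>). That place is the first fixed point of type \<open>l\<close>, so after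
  \<open>m + 1\<close> such steps the pieces are exactly the components of the first-return decomposition.

  Each splitting is a Cauchy product of power series. Hence the components of \<open>p\<close> vary freely and
  independently over all parking distributions of total length \<open>n - 1\<close>, and a weight that is a
  product of functions of the separate components has as its generating function a product of
  \<open>m + 1\<close> series (lemma \<open>sum_bounded_seqs_pieces\<close>). Under the recursion for the statistics the weight
  \<open>\<Prod>i. q\<^sub>i ^ S i p\<close> has this form, and equidistribution turns the \<open>i\<close>-th factor into the series
  for \<open>luck\<close>.
\<close>

unbundle fps_syntax

section \<open>Sequences below a line of slope m\<close>

definition bounded_seqs :: "nat \<Rightarrow> nat \<Rightarrow> nat \<Rightarrow> nat list set" where
  "bounded_seqs m l n =
     {q. length q = n \<and> sorted q \<and> (\<forall>k<n. 1 \<le> q ! k \<and> q ! k \<le> m * k + l)}"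

text \<open>
  The first fixed point of type \<open>t\<close> of \<open>1 # q\<close>, counted as a position in \<open>q\<close> from 0. It is also
  meaningful for the extreme types \<open>t = 0\<close> and \<open>t = m + 1\<close>, where it is the start and the end of
  \<open>q\<close>, so no break point has to be treated separately.
\<close>

definition break_pos :: "nat \<Rightarrow> nat \<Rightarrow> nat list \<Rightarrow> nat" where
  "break_pos m t q = (LEAST k. length q \<le> k \<or> m * k + t < q ! k)"

definition piece :: "nat \<Rightarrow> nat \<Rightarrow> nat list \<Rightarrow> nat list" where
  "piece m t q =
     map (\<lambda>k. q ! k - (q ! break_pos m t q - 1)) [break_pos m t q ..< break_pos m (Suc t) q]"

definition glue :: "nat \<Rightarrow> nat \<Rightarrow> nat list \<Rightarrow> nat list \<Rightarrow> nat list" where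
  "glue m l a c = a @ map (\<lambda>x. x + (m * length a + l)) c"

lemma bounded_seqsD:
  assumes "q \<in> bounded_seqs m l n"
  shows "length q = n" "sorted q" "\<And>k. k < n \<Longrightarrow> 1 \<le> q ! k" "\<And>k. k < n \<Longrightarrow> q ! k \<le> m * k + l"
  using assms by (auto simp: bounded_seqs_def)

lemma bounded_seqs_one: "bounded_seqs m 1 n = PK m n"
proof -
  have "(\<forall>k<n. 1 \<le> q ! k \<and> q ! k \<le> m * k + 1) \<longleftrightarrow>
        (\<forall>i\<in>{1..n}. 1 \<le> entry q i \<and> entry q i \<le> m * (i - 1) + 1)" (is "?L \<longleftrightarrow> ?R") for q
  proof
    assume ?L
    then show ?R
      by (auto simp: entry_def)
  next
    assume R: ?R
    show ?L
    proof (intro allI impI)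
      fix k assume "k < n"
      then show "1 \<le> q ! k \<and> q ! k \<le> m * k + 1"
        using R[rule_format, of "Suc k"] by (simp add: entry_def)
    qed
  qed
  then show ?thesis
    by (simp only: bounded_seqs_def PK_def)
qed

lemma bounded_seqs_zero: "bounded_seqs m 0 n = (if n = 0 then {[]} else {})"
  by (auto simp: bounded_seqs_def)

lemma PK_Suc: "PK m (Suc n) = (#) 1 ` bounded_seqs m (m + 1) n"
proof (intro subset_antisym subsetI)
  fix p assume "p \<in> PK m (Suc n)"
  then have p: "p \<in> bounded_seqs m 1 (Suc n)"
    by (simp only: bounded_seqs_one)
  note D = bounded_seqsD[OF p]
  obtain x q where [simp]: "p = x # q"
    using D(1) by (cases p) auto
  have "x = 1"
    using D(3,4)[of 0] by simp
  moreover have "q \<in> bounded_seqs m (m + 1) n"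
    unfolding bounded_seqs_def
  proof (intro CollectI conjI allI impI)
    fix k assume "k < n"
    then show "1 \<le> q ! k" "q ! k \<le> m * k + (m + 1)"
      using D(3,4)[of "Suc k"] by simp_all
  qed (use D(1,2) in auto)
  ultimately show "p \<in> (#) 1 ` bounded_seqs m (m + 1) n"
    by simp
next
  fix p assume "p \<in> (#) 1 ` bounded_seqs m (m + 1) n"
  then obtain q where [simp]: "p = 1 # q" and q: "q \<in> bounded_seqs m (m + 1) n"
    by blast
  note D = bounded_seqsD[OF q]
  have "p \<in> bounded_seqs m 1 (Suc n)"
    unfolding bounded_seqs_def
  proof (intro CollectI conjI allI impI)
    fix k assume "k < Suc n"
    then show "1 \<le> p ! k" "p ! k \<le> m * k + 1"
      using D(3,4)[of "k - 1"] by (cases k; simp)+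
  next
    show "sorted p"
      using D(1,2,3) by (auto simp: in_set_conv_nth)
  qed (use D(1) in simp)
  then show "p \<in> PK m (Suc n)"
    by (simp only: bounded_seqs_one)
qed

section \<open>Break positions and gluing\<close>

lemma break_pos_le_length: "break_pos m t q \<le> length q"
  unfolding break_pos_def by (rule Least_le) simp

lemma before_break_pos: "k < break_pos m t q \<Longrightarrow> q ! k \<le> m * k + t"
  unfolding break_pos_def by (drule not_less_Least) simp

lemma at_break_pos:
  assumes "break_pos m t q < length q"
  shows "m * break_pos m t q + t < q ! break_pos m t q"
proof -
  have "length q \<le> break_pos m t q \<or> m * break_pos m t q + t < q ! break_pos m t q"
    unfolding break_pos_def by (rule LeastI[of _ "length q"]) simp
  then show ?thesis
    using assms by simp
qed

lemma break_pos_eqI: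
  assumes "k \<le> length q" "\<And>j. j < k \<Longrightarrow> q ! j \<le> m * j + t"
    and "k < length q \<Longrightarrow> m * k + t < q ! k"
  shows "break_pos m t q = k"
  unfolding break_pos_def
proof (rule Least_equality)
  show "length q \<le> k \<or> m * k + t < q ! k"
    using assms(3) by linarith
  show "k \<le> j" if "length q \<le> j \<or> m * j + t < q ! j" for j
    using that assms(1) assms(2)[of j] by (meson leI le_trans not_le)
qed

lemma break_pos_zero: "q \<in> bounded_seqs m l n \<Longrightarrow> break_pos m 0 q = 0"
  using bounded_seqsD(1,3)[of q m l n] by (intro break_pos_eqI) force+

lemma break_pos_full:
  "q \<in> bounded_seqs m l n \<Longrightarrow> l \<le> t \<Longrightarrow> break_pos m t q = n"
  using bounded_seqsD(1,4)[of q m l n] by (intro break_pos_eqI) force+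

lemma break_pos_glue:
  assumes a: "a \<in> bounded_seqs m l j" and c: "c \<in> PK m i" and "t \<le> l"
  shows "break_pos m t (glue m l a c) = break_pos m t a"
proof (rule break_pos_eqI)
  have len: "length a = j" "length c = i"
    using bounded_seqsD(1)[OF a] c by (auto simp: PK_def)
  let ?b = "break_pos m t a"
  have b: "?b \<le> length a"
    by (rule break_pos_le_length)
  then show "?b \<le> length (glue m l a c)"
    by (simp add: glue_def)
  show "glue m l a c ! k \<le> m * k + t" if "k < ?b" for k
    using before_break_pos[OF that] that b by (simp add: glue_def nth_append)
  assume less: "?b < length (glue m l a c)"
  show "m * ?b + t < glue m l a c ! ?b"
  proof (cases "?b < length a")
    case True
    then show ?thesis
      using at_break_pos[of m t a] by (simp add: glue_def nth_append)
  next
    case False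
    then have "?b = length a" "0 < i"
      using b less len by (auto simp: glue_def)
    then show ?thesis
      using bounded_seqsD(3)[of c m 1 i 0] c \<open>t \<le> l\<close> len
      by (simp add: glue_def nth_append bounded_seqs_one[simplified])
  qed
qed

lemma break_pos_glue_last:
  assumes "a \<in> bounded_seqs m l j" "c \<in> PK m i"
  shows "break_pos m l (glue m l a c) = j"
  using break_pos_glue[OF assms order_refl] break_pos_full[OF assms(1) order_refl] by simp

text \<open>
  Monotonicity survives at the seam because every entry of \<open>a\<close> is at most \<open>m * j + l\<close>, the amount
  by which \<open>c\<close> is raised. An entry of \<open>c\<close> at position \<open>d\<close> is at most \<open>m * d + 1\<close>, so it ends up
  below the bound \<open>m * (j + d) + l + 1\<close>.
\<close>

lemma glue_in_bounded_seqs: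
  assumes a: "a \<in> bounded_seqs m l j" and c: "c \<in> PK m i"
  shows "glue m l a c \<in> bounded_seqs m (Suc l) (j + i)"
proof -
  note A = bounded_seqsD[OF a]
  have "c \<in> bounded_seqs m 1 i"
    using c by (simp only: bounded_seqs_one)
  note B = bounded_seqsD[OF this]
  have "x \<le> m * j + l" if x: "x \<in> set a" for x
  proof -
    obtain k where "k < j" "x = a ! k"
      using x A(1) by (auto simp: in_set_conv_nth)
    then have "x \<le> m * k + l" "m * k \<le> m * j"
      using A(4) by simp_all
    then show ?thesis
      by linarith
  qed
  then have "sorted (glue m l a c)"
    using A(1,2) B(2) by (auto simp: glue_def sorted_append sorted_map intro: trans_le_add2)
  moreover have "1 \<le> glue m l a c ! k \<and> glue m l a c ! k \<le> m * k + Suc l" if k: "k < j + i" for k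
  proof (cases "k < j")
    case True
    then show ?thesis
      using A(1) A(3,4)[of k] by (simp add: glue_def nth_append)
  next
    case False
    then obtain d where d: "k = j + d" "d < i"
      using k by (metis le_Suc_ex leI nat_add_left_cancel_less)
    then show ?thesis
      using A(1) B(1) B(3,4)[of d] by (simp add: glue_def nth_append algebra_simps)
  qed
  ultimately show ?thesis
    using A(1) B(1) by (simp add: bounded_seqs_def glue_def)
qed

text \<open>
  The cut is at the break position \<open>b\<close> of type \<open>l\<close>. The entry there exceeds \<open>m * b + l\<close>, and by
  monotonicity so do all later ones; hence this amount can be subtracted from the whole remainder
  and leaves positive entries.
\<close>

lemma ex_glue:
  assumes q: "q \<in> bounded_seqs m (Suc l) n"
  obtains j a c where "j \<le> n" "a \<in> bounded_seqs m l j" "c \<in> PK m (n - j)" "q = glue m l a c"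
proof
  note D = bounded_seqsD[OF q]
  define b where "b = break_pos m l q"
  define h where "h = m * b + l"
  let ?c = "map (\<lambda>x. x - h) (drop b q)"
  show b: "b \<le> n"
    using break_pos_le_length[of m l q] D(1) by (simp add: b_def)
  show "take b q \<in> bounded_seqs m l b"
    using b D before_break_pos[of _ m l q]
    by (auto simp: bounded_seqs_def b_def[symmetric] sorted_wrt_take)
  have above: "h < q ! k" if k: "b \<le> k" "k < n" for k
  proof -
    have "h < q ! b"
      using at_break_pos[of m l q] k D(1) by (simp add: b_def h_def)
    also have "q ! b \<le> q ! k"
      using sorted_nth_mono[OF D(2)] k D(1) by simp
    finally show ?thesis .
  qed
  have "?c \<in> bounded_seqs m 1 (n - b)"
    unfolding bounded_seqs_def
  proof (intro CollectI conjI allI impI)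
    show "sorted ?c"
      using sorted_wrt_drop[OF D(2), of b]
      by (auto simp: sorted_wrt_iff_nth_less intro!: diff_le_mono)
    fix k assume k: "k < n - b"
    then have bk: "b + k < n"
      by linarith
    then show "1 \<le> ?c ! k"
      using above[of "b + k"] b D(1) by simp
    show "?c ! k \<le> m * k + 1"
      using D(4)[of "b + k"] bk b D(1) by (simp add: h_def algebra_simps)
  qed (use D(1) in simp)
  then show "?c \<in> PK m (n - b)"
    by (simp only: bounded_seqs_one)
  have "map (\<lambda>x. x - h + h) (drop b q) = drop b q"
    using above D(1) by (auto intro!: nth_equalityI simp: less_imp_le)
  then show "q = glue m l (take b q) ?c"
    using b D(1) by (simp add: glue_def h_def comp_def)
qed

section \<open>Unique decomposition\<close>

text \<open>
  Injectivity comes from the fact that the place of the seam can be recovered from the glued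
  sequence: it is its break position of type \<open>l\<close>.
\<close>

lemma bij_betw_glue:
  "bij_betw (\<lambda>(j, a, c). glue m l a c)
     (SIGMA j:{0..n}. bounded_seqs m l j \<times> PK m (n - j)) (bounded_seqs m (Suc l) n)"
proof (rule bij_betw_imageI)
  show "inj_on (\<lambda>(j, a, c). glue m l a c) (SIGMA j:{0..n}. bounded_seqs m l j \<times> PK m (n - j))"
  proof (rule inj_onI)
    fix z z'
    assume z: "z \<in> (SIGMA j:{0..n}. bounded_seqs m l j \<times> PK m (n - j))"
      "z' \<in> (SIGMA j:{0..n}. bounded_seqs m l j \<times> PK m (n - j))"
      and eq_z: "(\<lambda>(j, a, c). glue m l a c) z = (\<lambda>(j, a, c). glue m l a c) z'"
    obtain j a c j' a' c' where zz': "z = (j, a, c)" "z' = (j', a', c')"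
      by (metis prod_cases3)
    then have a: "a \<in> bounded_seqs m l j" and c: "c \<in> PK m (n - j)"
      and a': "a' \<in> bounded_seqs m l j'" and c': "c' \<in> PK m (n - j')"
      and eq: "glue m l a c = glue m l a' c'"
      using z eq_z by auto
    have "j = j'"
      using break_pos_glue_last[OF a c] break_pos_glue_last[OF a' c'] eq by simp
    moreover from this have "length a = length a'"
      using bounded_seqsD(1)[OF a] bounded_seqsD(1)[OF a'] by simp
    moreover from this have "a = a'" "c = c'"
      using eq by (auto simp: glue_def intro: map_injective injI)
    ultimately show "z = z'"
      by (simp add: zz')
  qed
  show "(\<lambda>(j, a, c). glue m l a c) ` (SIGMA j:{0..n}. bounded_seqs m l j \<times> PK m (n - j))
        = bounded_seqs m (Suc l) n"
  proof (intro subset_antisym subsetI)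
    fix q assume "q \<in> bounded_seqs m (Suc l) n"
    then obtain j a c where "j \<le> n" "a \<in> bounded_seqs m l j" "c \<in> PK m (n - j)" "q = glue m l a c"
      by (rule ex_glue)
    then show "q \<in> (\<lambda>(j, a, c). glue m l a c) `
                     (SIGMA j:{0..n}. bounded_seqs m l j \<times> PK m (n - j))"
      by force
  next
    fix q assume "q \<in> (\<lambda>(j, a, c). glue m l a c) `
                         (SIGMA j:{0..n}. bounded_seqs m l j \<times> PK m (n - j))"
    then obtain j a c where "j \<le> n" "a \<in> bounded_seqs m l j" "c \<in> PK m (n - j)" "q = glue m l a c"
      by auto
    then show "q \<in> bounded_seqs m (Suc l) n"
      using glue_in_bounded_seqs[of a m l j c "n - j"] by simp
  qed
qed

lemma piece_glue_less:
  assumes a: "a \<in> bounded_seqs m l j" and c: "c \<in> PK m i" and "t < l"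
  shows "piece m t (glue m l a c) = piece m t a"
proof -
  have "break_pos m t (glue m l a c) = break_pos m t a"
    "break_pos m (Suc t) (glue m l a c) = break_pos m (Suc t) a"
    using break_pos_glue[OF a c] \<open>t < l\<close> by simp_all
  moreover have "break_pos m (Suc t) a \<le> length a"
    by (rule break_pos_le_length)
  ultimately show ?thesis
    by (auto simp: piece_def glue_def nth_append)
qed

text \<open>
  A nonempty \<open>c\<close> starts with 1, so the normalisation built into \<open>piece\<close>, by the first entry of the
  segment, lowers it by exactly the amount that gluing has added.
\<close>

lemma piece_glue_last:
  assumes a: "a \<in> bounded_seqs m l j" and c: "c \<in> PK m i"
  shows "piece m l (glue m l a c) = c"
proof -
  have len: "length a = j"
    using bounded_seqsD(1)[OF a] .
  have "c \<in> bounded_seqs m 1 i"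
    using c by (simp only: bounded_seqs_one)
  note B = bounded_seqsD[OF this]
  have start: "break_pos m l (glue m l a c) = j"
    by (rule break_pos_glue_last[OF a c])
  have stop: "break_pos m (Suc l) (glue m l a c) = j + i"
    by (rule break_pos_full[OF glue_in_bounded_seqs[OF a c] order_refl])
  let ?g = "glue m l a c"
  have "map (\<lambda>k. ?g ! k - (?g ! j - 1)) [j..<j + i] = c"
  proof (rule nth_equalityI)
    show "length (map (\<lambda>k. ?g ! k - (?g ! j - 1)) [j..<j + i]) = length c"
      by (simp add: B(1))
    fix k assume "k < length (map (\<lambda>k. ?g ! k - (?g ! j - 1)) [j..<j + i])"
    then have k: "k < i"
      by simp
    have "c ! 0 = 1"
      using B(3,4)[of 0] k by simp
    then show "map (\<lambda>k. ?g ! k - (?g ! j - 1)) [j..<j + i] ! k = c ! k"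
      using k len B(1) by (simp add: glue_def nth_append)
  qed
  then show ?thesis
    by (simp only: piece_def start stop)
qed

section \<open>Generating functions of product weights\<close>

text \<open>
  Along \<open>glue\<close> the length adds up and the weight factors, so raising \<open>l\<close> by one multiplies the
  generating function by that of a single parking distribution.
\<close>

lemma sum_bounded_seqs_pieces:
  fixes f :: "nat \<Rightarrow> nat list \<Rightarrow> 'a::comm_ring_1"
  shows "(\<Sum>q\<in>bounded_seqs m l n. \<Prod>t<l. f t (piece m t q)) =
         (\<Prod>t<l. Abs_fps (\<lambda>n. \<Sum>p\<in>PK m n. f t p)) $ n"
proof (induction l arbitrary: n)
  case 0
  show ?case
    by (simp add: bounded_seqs_zero)
next
  case (Suc l)
  let ?F = "\<lambda>t. Abs_fps (\<lambda>n. \<Sum>p\<in>PK m n. f t p)"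
  let ?w = "\<lambda>l q. \<Prod>t<l. f t (piece m t q)"
  have finite: "finite (bounded_seqs m l j)" for j
  proof (rule finite_subset)
    show "bounded_seqs m l j \<subseteq> {q. set q \<subseteq> {..m * j + l} \<and> length q = j}"
    proof (clarsimp simp: bounded_seqs_def in_set_conv_nth)
      fix q :: "nat list" and k
      assume "\<forall>k<length q. Suc 0 \<le> q ! k \<and> q ! k \<le> m * k + l" "k < length q"
      then have "q ! k \<le> m * k + l" "m * k \<le> m * length q"
        by simp_all
      then show "q ! k \<le> m * length q + l"
        by linarith
    qed
  qed (simp add: finite_lists_length_eq)
  have weight: "?w (Suc l) (glue m l a c) = ?w l a * f l c"
    if "a \<in> bounded_seqs m l j" "c \<in> PK m i" for a c i j
  proof -
    have "?w l (glue m l a c) = ?w l a"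
      using piece_glue_less[OF that] by (intro prod.cong) auto
    then show ?thesis
      by (simp add: piece_glue_last[OF that])
  qed
  have "(\<Sum>q\<in>bounded_seqs m (Suc l) n. ?w (Suc l) q) =
        (\<Sum>(j, a, c)\<in>(SIGMA j:{0..n}. bounded_seqs m l j \<times> PK m (n - j)).
           ?w (Suc l) (glue m l a c))"
    by (subst sum.reindex_bij_betw[OF bij_betw_glue[of m l n], symmetric])
       (simp add: case_prod_unfold)
  also have "\<dots> = (\<Sum>(j, a, c)\<in>(SIGMA j:{0..n}. bounded_seqs m l j \<times> PK m (n - j)).
                    ?w l a * f l c)"
    by (intro sum.cong refl) (auto simp only: mem_Sigma_iff split_beta fst_conv snd_conv weight)
  also have "\<dots> = (\<Sum>j=0..n. \<Sum>(a, c)\<in>bounded_seqs m l j \<times> PK m (n - j). ?w l a * f l c)"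
    by (subst sum.Sigma) (auto simp: finite finite_PK)
  also have "\<dots> = (\<Sum>j=0..n. (\<Sum>a\<in>bounded_seqs m l j. ?w l a) * (\<Sum>c\<in>PK m (n - j). f l c))"
    by (simp only: sum_product sum.cartesian_product)
  also have "\<dots> = ((\<Prod>t<l. ?F t) * ?F l) $ n"
    by (simp add: fps_mult_nth Suc.IH)
  finally show ?case
    by simp
qed

section \<open>The first-return decomposition\<close>

lemma break_point_Cons:
  assumes q: "q \<in> bounded_seqs m (m + 1) n" and "j \<le> m + 1"
  shows "break_point m (1 # q) j = break_pos m j q + 2"
proof -
  note D = bounded_seqsD[OF q]
  let ?b = "break_pos m j q"
  consider "j = 0" | "j = m + 1" | "0 < j" "j \<le> m"
    using \<open>j \<le> m + 1\<close> by linarith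
  then show ?thesis
  proof cases
    case 1
    then show ?thesis
      by (simp add: break_point_def break_pos_zero[OF q])
  next
    case 2
    then show ?thesis
      using break_pos_full[OF q order_refl] D(1) by (simp add: break_point_def)
  next
    case 3
    (* The bound q ! k <= m * k + (m + 1) on tails is the upper bound required of a fixed point. *)
    have member: "k + 2 \<in> fixed_points m j (1 # q) \<longleftrightarrow> k < n \<and> m * k + j < q ! k" for k
      using D(1) D(4)[of k] by (auto simp: fixed_points_def entry_def)
    have form: "\<exists>k. x = k + 2" if "x \<in> fixed_points m j (1 # q)" for x
    proof
      show "x = (x - 2) + 2"
        using that unfolding fixed_points_def by (simp only: mem_Collect_eq) arith
    qed
    have least: "?b + 2 \<le> x" if x: "x \<in> fixed_points m j (1 # q)" for x
    proof -
      obtain k where k: "x = k + 2"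
        using form[OF x] by blast
      then have "m * k + j < q ! k"
        using x member by blast
      then have "\<not> k < ?b"
        using before_break_pos[of k m j q] by linarith
      with k show ?thesis
        by linarith
    qed
    have "first_fixed_point m j (1 # q) = ?b + 2"
    proof (cases "?b < n")
      case True
      then have mem: "?b + 2 \<in> fixed_points m j (1 # q)"
        using member at_break_pos[of m j q] D(1) by blast
      have "finite (fixed_points m j (1 # q))"
        by (rule finite_subset[of _ "{..length (1 # q)}"]) (auto simp: fixed_points_def)
      then have "Min (fixed_points m j (1 # q)) = ?b + 2"
        using least mem by (rule Min_eqI)
      moreover have "fixed_points m j (1 # q) \<noteq> {}"
        using mem by blast
      ultimately show ?thesis
        by (simp add: first_fixed_point_def)
    next
      case False
      then have b: "?b = n"
        using break_pos_le_length[of m j q] D(1) by simp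
      have "fixed_points m j (1 # q) = {}"
        using least form member b by fastforce
      then show ?thesis
        using b D(1) by (simp add: first_fixed_point_def)
    qed
    with 3 show ?thesis
      by (simp add: break_point_def)
  qed
qed

lemma component_Cons:
  assumes q: "q \<in> bounded_seqs m (m + 1) n" and "t \<le> m"
  shows "component m (1 # q) (t + 1) = piece m t q"
proof -
  have "break_point m (1 # q) t = break_pos m t q + 2"
    "break_point m (1 # q) (t + 1) = break_pos m (Suc t) q + 2"
    using break_point_Cons[OF q, of t] break_point_Cons[OF q, of "Suc t"] \<open>t \<le> m\<close> by simp_all
  then show ?thesis
    by (auto intro!: nth_equalityI simp: component_def piece_def entry_def simp del: upt_Suc)
qed

section \<open>Equidistributed statistics\<close>

lemma sum_cong_equidistributed:
  fixes g :: "'b \<Rightarrow> 'a::comm_ring_1"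
  assumes "finite A" and "\<And>k. card {p \<in> A. s p = k} = card {p \<in> A. t p = k}"
  shows "(\<Sum>p\<in>A. g (s p)) = (\<Sum>p\<in>A. g (t p))"
proof -
  let ?K = "s ` A \<union> t ` A"
  have by_value: "(\<Sum>p\<in>A. g (r p)) = (\<Sum>k\<in>?K. of_nat (card {p \<in> A. r p = k}) * g k)"
    if "r ` A \<subseteq> ?K" for r
  proof -
    have "(\<Sum>p\<in>A. g (r p)) = (\<Sum>k\<in>?K. \<Sum>p\<in>{p \<in> A. r p = k}. g (r p))"
      using assms(1) that by (intro sum.group[symmetric]) auto
    also have "\<dots> = (\<Sum>k\<in>?K. \<Sum>p\<in>{p \<in> A. r p = k}. g k)"
      by (intro sum.cong) auto
    finally show ?thesis
      by simp
  qed
  show ?thesis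
    using by_value[of s] by_value[of t] assms(2) by simp
qed

theorem theorem7p2:
  fixes m :: nat and S :: "nat \<Rightarrow> nat list \<Rightarrow> nat" and C :: "nat \<Rightarrow> nat"
  assumes "m \<ge> 1"
    and equidistributed:
      "\<And>i n k. i \<le> m \<Longrightarrow> card {p \<in> PK m n. S i p = k} = card {p \<in> PK m n. luck m p = k}"
    and recursive:
      "\<And>i n p. i \<le> m \<Longrightarrow> n \<ge> 1 \<Longrightarrow> p \<in> PK m n \<Longrightarrow> S i p = S i (component m p (i + 1)) + C i"
  shows "joint_gf m S indet =
         1 + fps_X * (\<Prod>i\<in>{0..m}. fps_const (indet i ^ C i) * luck_gf m (indet i))"
proof (rule fps_ext)
  let ?P = "\<Prod>i\<in>{0..m}. fps_const (indet i ^ C i) * luck_gf m (indet i)"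
  have range: "{0..m} = {..<m + 1}"
    by auto
  have gf: "Abs_fps (\<lambda>n. \<Sum>p\<in>PK m n. indet i ^ S i p) = luck_gf m (indet i)" if "i \<le> m" for i
    unfolding luck_gf_def
    using sum_cong_equidistributed[OF finite_PK equidistributed[OF that], of "\<lambda>k. indet i ^ k"]
    by simp
  have PK_0: "PK m 0 = {[]}"
    by (auto simp: PK_def)
  (* The recursion does not reach the empty sequence; equidistribution fixes its value. *)
  have S_Nil: "S i [] = 0" if "i \<le> m" for i
  proof -
    have "card {p \<in> PK m 0. S i p = 0} = card {p \<in> PK m 0. luck m p = 0}"
      by (rule equidistributed[OF that])
    also have "{p \<in> PK m 0. luck m p = 0} = {[]}"
      by (auto simp: PK_0 luck_def)
    finally have "{p \<in> PK m 0. S i p = 0} \<noteq> {}"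
      by (intro notI) simp
    then show ?thesis
      by (auto simp: PK_0)
  qed
  fix n
  show "joint_gf m S indet $ n = (1 + fps_X * ?P) $ n"
  proof (cases n)
    case 0
    then show ?thesis
      by (simp add: joint_gf_def PK_0 S_Nil)
  next
    case (Suc n')
    have S_Cons: "S i (1 # q) = S i (piece m i q) + C i"
      if "q \<in> bounded_seqs m (m + 1) n'" "i \<le> m" for i q
    proof -
      have mem: "1 # q \<in> PK m (Suc n')"
        using that(1) by (simp only: PK_Suc image_eqI)
      then show ?thesis
        using recursive[OF that(2) _ mem] component_Cons[OF that] by simp
    qed
    have "joint_gf m S indet $ n =
          (\<Sum>q\<in>bounded_seqs m (m + 1) n'. \<Prod>i\<in>{0..m}. indet i ^ S i (1 # q))"
      unfolding joint_gf_def Suc PK_Suc fps_nth_Abs_fps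
      by (subst sum.reindex) (simp_all add: o_def)
    also have "\<dots> = (\<Sum>q\<in>bounded_seqs m (m + 1) n'.
                      (\<Prod>i\<in>{0..m}. indet i ^ C i) * (\<Prod>i<m + 1. indet i ^ S i (piece m i q)))"
    proof (rule sum.cong[OF refl])
      fix q assume "q \<in> bounded_seqs m (m + 1) n'"
      then have "(\<Prod>i\<in>{0..m}. indet i ^ S i (1 # q)) =
                 (\<Prod>i\<in>{0..m}. indet i ^ C i * indet i ^ S i (piece m i q))"
        by (intro prod.cong refl) (simp add: S_Cons[simplified] power_add mult.commute)
      then show "(\<Prod>i\<in>{0..m}. indet i ^ S i (1 # q)) =
                 (\<Prod>i\<in>{0..m}. indet i ^ C i) * (\<Prod>i<m + 1. indet i ^ S i (piece m i q))"
        by (simp only: prod.distrib range)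
    qed
    also have "\<dots> = (\<Prod>i\<in>{0..m}. indet i ^ C i) *
                    (\<Prod>i<m + 1. Abs_fps (\<lambda>n. \<Sum>p\<in>PK m n. indet i ^ S i p)) $ n'"
      by (simp only: sum_distrib_left[symmetric]
            sum_bounded_seqs_pieces[where f = "\<lambda>i p. indet i ^ S i p"])
    also have "(\<Prod>i<m + 1. Abs_fps (\<lambda>n. \<Sum>p\<in>PK m n. indet i ^ S i p)) =
               (\<Prod>i\<in>{0..m}. luck_gf m (indet i))"
      unfolding range using gf by (intro prod.cong) auto
    also have "(\<Prod>i\<in>{0..m}. indet i ^ C i) * (\<Prod>i\<in>{0..m}. luck_gf m (indet i)) $ n' = ?P $ n'"
    proof -
      have "(\<Prod>i\<in>A. fps_const (indet i ^ C i)) = fps_const (\<Prod>i\<in>A. indet i ^ C i)" for A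
        by (induction A rule: infinite_finite_induct) simp_all
      then show ?thesis
        by (simp only: prod.distrib fps_mult_left_const_nth)
    qed
    finally show ?thesis
      by (simp add: Suc)
  qed
qed

end
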